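(* Let $G$ be a graph on $n$ vertices and suppose that $\{\mathrm{diff}_\ell\}$ is monotonically increasing in $G$. If for some $k\in\{1,\dots,n-1\}$ we have $\mathrm{diff}_k<\mathrm{diff}_{k+1}$, then any optimal solution of (SkS-L') with $\lambda\in(\mathrm{diff}_k,\mathrm{diff}_{k+1})$ is (the incidence vector of) a sparsest $k$-subgraph in $G$.
   Context: Graphs are simple, undirected and finite, with vertex set $\{1,\dots,n\}$; $A$ is the adjacency matrix of $G$ and $e$ is the all-ones vector of length $n$. For $\ell\in\{1,\dots,n\}$, $m_\ell := \min\{\tfrac12 x^TAx \mid e^Tx=\ell,\ x\in\{0,1\}^n\}$ is the minimum number of edges in an induced subgraph of $G$ on $\ell$ vertices. A sparsest $k$-subgraph is an induced subgraph on $k$ vertices with exactly $m_k$ edges; its incidence vector $x\in\{0,1\}^n$ has $x_i=1$ iff vertex $i$ belongs to the subgraph. Set $\mathrm{diff}_1 := m_1 = 0$ and $\mathrm{diff}_\ell := m_\ell - m_{\ell-1}$ for $2\le\ell\le n$. The sequence $\{\mathrm{diff}_\ell\}$ is called monotonically increasing in $G$ if $\mathrm{diff}_\ell\le\mathrm{diff}_{\ell+1}$ for all $\ell\in\{1,\dots,n-1\}$. For $\lambda\in\mathbb{R}$, the Lagrangian relaxation (up to an additive constant) is $$\text{(SkS-L')}\qquad \min\left\{\tfrac12 x^TAx-\lambda e^Tx \mid x\in\{0,1\}^n\right\}.$$ *)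

theory Defs
  imports "HOL-Analysis.Analysis"
begin

text \<open>
  The vertex set is the whole finite type 'n, so the number of vertices is CARD('n), and
  a graph is given by its set of edges, each edge being the set of its two endpoints.
\<close>

definition simple_graph :: "'n::finite set set \<Rightarrow> bool" where
  "simple_graph E \<longleftrightarrow> (\<forall>e\<in>E. card e = 2)"

definition adjacency_matrix :: "'n::finite set set \<Rightarrow> real ^ 'n ^ 'n" where
  "adjacency_matrix E = (\<chi> i j. if {i, j} \<in> E then 1 else 0)"

definition all_ones :: "real ^ 'n::finite" where
  "all_ones = (\<chi> i. 1)"

definition binary_vectors :: "(real ^ 'n::finite) set" where
  "binary_vectors = {x. \<forall>i. x $ i \<in> {0, 1}}"

definition incidence_vector :: "'n::finite set \<Rightarrow> real ^ 'n" where
  "incidence_vector S = (\<chi> i. if i \<in> S then 1 else 0)"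

text \<open>
  The set under \<open>Min\<close> is finite, and it is nonempty exactly if \<open>l \<le> CARD('n)\<close>; beyond that
  range the value is unspecified.
\<close>

definition min_edges :: "'n::finite set set \<Rightarrow> nat \<Rightarrow> real" where
  "min_edges E l =
     Min {(1 / 2) * (x \<bullet> (adjacency_matrix E *v x)) | x.
            all_ones \<bullet> x = real l \<and> x \<in> binary_vectors}"

definition induced_edges :: "'n::finite set set \<Rightarrow> 'n set \<Rightarrow> 'n set set" where
  "induced_edges E S = {e \<in> E. e \<subseteq> S}"

text \<open>An induced subgraph is identified with its vertex set \<open>S\<close>.\<close>

definition sparsest_subgraph :: "'n::finite set set \<Rightarrow> nat \<Rightarrow> 'n set \<Rightarrow> bool" where
  "sparsest_subgraph E k S \<longleftrightarrow>
     card S = k \<and> real (card (induced_edges E S)) = min_edges E k"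

text \<open>Only the values at \<open>1 \<le> l \<le> CARD('n)\<close> are meaningful.\<close>

definition edge_diff :: "'n::finite set set \<Rightarrow> nat \<Rightarrow> real" where
  "edge_diff E l = (if l = 1 then min_edges E 1 else min_edges E l - min_edges E (l - 1))"

definition edge_diff_increasing :: "'n::finite set set \<Rightarrow> bool" where
  "edge_diff_increasing E \<longleftrightarrow>
     (\<forall>l\<in>{1..CARD('n) - 1}. edge_diff E l \<le> edge_diff E (l + 1))"

definition lagrangian :: "'n::finite set set \<Rightarrow> real \<Rightarrow> real ^ 'n \<Rightarrow> real" where
  "lagrangian E \<mu> x =
     (1 / 2) * (x \<bullet> (adjacency_matrix E *v x)) - \<mu> * (all_ones \<bullet> x)"

definition lagrangian_optimal :: "'n::finite set set \<Rightarrow> real \<Rightarrow> real ^ 'n \<Rightarrow> bool" where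
  "lagrangian_optimal E \<mu> x \<longleftrightarrow>
     is_arg_min (lagrangian E \<mu>) (\<lambda>y. y \<in> binary_vectors) x"

end

theory Submission
  imports Defs
begin

text \<open>
  Under monotonicity, the increments \<open>edge_diff E l - \<mu>\<close> of the sequence
  \<open>l \<mapsto> min_edges E l - \<mu> l\<close> are negative for \<open>l \<le> k\<close> and positive for \<open>l > k\<close>, so
  \<open>k\<close> is its only minimizer. The Lagrangian of a binary vector with \<open>l\<close> ones is at least
  the \<open>l\<close>-th term, with equality for the sparsest subgraphs only.
\<close>

text \<open>A 0/1 vector is recovered from the set of its entries equal to 1. This turns the
  optimization over vectors into one over vertex sets.\<close>

lemma binary_vectors_eq: "binary_vectors = range incidence_vector"
proof
  show "binary_vectors \<subseteq> range (incidence_vector :: 'n::finite set \<Rightarrow> _)"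
  proof
    fix x :: "real ^ 'n"
    assume "x \<in> binary_vectors"
    then have "x = incidence_vector {i. x $ i = 1}"
      by (auto simp: binary_vectors_def incidence_vector_def vec_eq_iff)
    then show "x \<in> range incidence_vector" by blast
  qed
qed (auto simp: binary_vectors_def incidence_vector_def)

lemma all_ones_inner_incidence: "all_ones \<bullet> incidence_vector S = real (card S)"
  by (simp add: all_ones_def incidence_vector_def inner_vec_def sum.If_cases)

text \<open>Double counting: the pairs are grouped by the edge \<open>{i, j}\<close> they span.
  Every edge has two distinct endpoints, so each group consists of \<open>(u, v)\<close> and
  \<open>(v, u)\<close>.\<close>

lemma card_adjacent_pairs:
  assumes "simple_graph (E :: 'n::finite set set)"
  shows "card {(i, j) \<in> S \<times> S. {i, j} \<in> E} = 2 * card (induced_edges E S)"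
proof -
  let ?F = "\<lambda>e. {(i, j). {i, j} = e}"
  have two: "card (?F e) = 2" if "e \<in> induced_edges E S" for e
  proof -
    have "card e = 2" using assms that by (auto simp: simple_graph_def induced_edges_def)
    then obtain u v where "e = {u, v}" "u \<noteq> v" by (auto simp: card_2_iff)
    then have "?F e = {(u, v), (v, u)}" by (auto simp: doubleton_eq_iff)
    with \<open>u \<noteq> v\<close> show ?thesis by simp
  qed
  have "{(i, j) \<in> S \<times> S. {i, j} \<in> E} = (\<Union>e\<in>induced_edges E S. ?F e)"
    by (auto simp: induced_edges_def)
  also have "card \<dots> = (\<Sum>e\<in>induced_edges E S. card (?F e))"
    by (rule card_UN_disjoint) auto
  also have "\<dots> = 2 * card (induced_edges E S)"
    using two by simp
  finally show ?thesis .
qed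

text \<open>The form sums 0/1 terms over ordered pairs and so counts adjacent ordered pairs in
  \<open>S\<close>; the factor 1/2 undoes the double count of each edge.\<close>

lemma quadratic_form_incidence:
  assumes "simple_graph (E :: 'n::finite set set)"
  shows "(1 / 2) * (incidence_vector S \<bullet> (adjacency_matrix E *v incidence_vector S)) =
    real (card (induced_edges E S))"
proof -
  have "incidence_vector S \<bullet> (adjacency_matrix E *v incidence_vector S) =
      (\<Sum>i\<in>UNIV. \<Sum>j\<in>UNIV. if i \<in> S \<and> j \<in> S \<and> {i, j} \<in> E then 1 else 0)"
    unfolding inner_vec_def matrix_vector_mult_def incidence_vector_def adjacency_matrix_def
    by (auto simp: sum_distrib_left intro!: sum.cong)
  also have "\<dots> = (\<Sum>p\<in>UNIV. if p \<in> {(i, j) \<in> S \<times> S. {i, j} \<in> E} then 1 else 0)"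
    unfolding sum.cartesian_product by (rule sum.cong) (auto split: if_splits)
  also have "\<dots> = real (card {(i, j) \<in> S \<times> S. {i, j} \<in> E})"
    by (simp only: sum.If_cases finite) simp
  finally show ?thesis unfolding card_adjacent_pairs[OF assms] by simp
qed

lemma lagrangian_incidence:
  assumes "simple_graph E"
  shows "lagrangian E \<mu> (incidence_vector S) =
    real (card (induced_edges E S)) - \<mu> * real (card S)"
  unfolding lagrangian_def quadratic_form_incidence[OF assms] all_ones_inner_incidence ..

lemma min_edges_eq:
  assumes "simple_graph E"
  shows "min_edges E l = Min {real (card (induced_edges E S)) | S. card S = l}"
proof -
  have "{(1 / 2) * (x \<bullet> (adjacency_matrix E *v x)) | x.
           all_ones \<bullet> x = real l \<and> x \<in> binary_vectors} =
        {real (card (induced_edges E S)) | S. card S = l}"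
    unfolding binary_vectors_eq quadratic_form_incidence[OF assms, symmetric]
    by (auto simp: all_ones_inner_incidence)
  then show ?thesis by (simp add: min_edges_def)
qed

lemma min_edges_le:
  assumes "simple_graph E"
  shows "min_edges E (card S) \<le> real (card (induced_edges E S))"
  unfolding min_edges_eq[OF assms] by (rule Min_le) auto

lemma sparsest_subgraph_exists:
  assumes "simple_graph (E :: 'n::finite set set)" and "l \<le> CARD('n)"
  shows "\<exists>S. sparsest_subgraph E l S"
proof -
  \<comment> \<open>\<open>T\<close> only shows that the set under \<open>Min\<close> is nonempty,
    so that the minimum is attained.\<close>
  obtain T :: "'n set" where "card T = l"
    using obtain_subset_with_card_n[OF assms(2)] by metis
  then have "Min {real (card (induced_edges E S)) | S. card S = l} \<in>
      {real (card (induced_edges E S)) | S. card S = l}"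
    by (intro Min_in) auto
  then show ?thesis
    unfolding sparsest_subgraph_def min_edges_eq[OF assms(1)] by force
qed

lemma min_edges_0:
  assumes "simple_graph E"
  shows "min_edges E 0 = 0"
proof -
  have "induced_edges E {} = {}"
    using assms by (auto simp: induced_edges_def simple_graph_def)
  then show ?thesis by (simp add: min_edges_eq[OF assms])
qed

text \<open>Since \<open>min_edges E 0 = 0\<close>, the separate clause of \<open>edge_diff\<close>
  at 1 agrees with the difference formula. The sequence can thus be telescoped from 0, which matters
  because the empty vertex set also competes in the relaxation.\<close>

lemma edge_diff_Suc:
  assumes "simple_graph E"
  shows "edge_diff E (Suc l) = min_edges E (Suc l) - min_edges E l"
  using min_edges_0[OF assms] by (simp add: edge_diff_def)

lemma edge_diff_mono:
  assumes "edge_diff_increasing (E :: 'n::finite set set)"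
    and "1 \<le> a" "a \<le> b" "b \<le> CARD('n)"
  shows "edge_diff E a \<le> edge_diff E b"
  using assms(3,4)
proof (induction b rule: dec_induct)
  case (step b)
  then have "b \<in> {1..CARD('n) - 1}" using assms(2) by auto
  then have "edge_diff E b \<le> edge_diff E (Suc b)"
    using assms(1) by (auto simp: edge_diff_increasing_def)
  with step show ?case by simp
qed simp

lemma relaxed_min_edges_less:
  assumes "simple_graph (E :: 'n::finite set set)" and "edge_diff_increasing E"
    and "1 \<le> k"
    and "edge_diff E k < \<mu>" "\<mu> < edge_diff E (Suc k)"
    and "l \<le> CARD('n)" "l \<noteq> k" "k < CARD('n)"
  shows "min_edges E k - \<mu> * real k < min_edges E l - \<mu> * real l"
proof -
  define g where "g l = min_edges E l - \<mu> * real l" for l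
  have g_Suc: "g (Suc j) = g j + (edge_diff E (Suc j) - \<mu>)" for j
    by (simp add: g_def edge_diff_Suc[OF assms(1)] algebra_simps)
  \<comment> \<open>By monotonicity, the increments beyond \<open>k\<close> are at least
    \<open>edge_diff E (Suc k)\<close>, hence above \<open>\<mu>\<close>; those up to
    \<open>k\<close> are at most \<open>edge_diff E k\<close>, hence below
    \<open>\<mu>\<close>.\<close>
  have up: "g j < g (Suc j)" if "k \<le> j" "j < CARD('n)" for j
    using edge_diff_mono[OF assms(2), of "Suc k" "Suc j"] that assms(5) by (simp add: g_Suc)
  have down: "g (Suc j) < g j" if "j < k" for j
    using edge_diff_mono[OF assms(2), of "Suc j" k] that assms(4,8) by (simp add: g_Suc)
  have "g k < g l"
  proof (cases "k < l")
    case True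
    then have "Suc k \<le> l" by simp
    then show ?thesis using assms(6)
    proof (induction l rule: dec_induct)
      case base
      then show ?case using up by simp
    next
      case (step j)
      then show ?case using up[of j] by simp
    qed
  next
    case False
    with assms(7) have "l < k" by simp
    then show ?thesis
    \<comment> \<open>The induction descends from \<open>k\<close>: its base case is
      \<open>k = Suc j\<close>.\<close>
    proof (induction rule: strict_inc_induct)
      case (base j)
      then show ?case using down[of j] by simp
    next
      case (step j)
      then show ?case using down[of j] by simp
    qed
  qed
  then show ?thesis by (simp add: g_def)
qed

theorem corollary17:
  fixes E :: "'n::finite set set" and k :: nat and \<mu> :: real and x :: "real ^ 'n"
  assumes "simple_graph E"
    and "edge_diff_increasing E"
    and "k \<in> {1..CARD('n) - 1}"
    and "edge_diff E k < edge_diff E (k + 1)"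
    and "\<mu> \<in> {edge_diff E k<..<edge_diff E (k + 1)}"
    and "lagrangian_optimal E \<mu> x"
  shows "\<exists>S. sparsest_subgraph E k S \<and> x = incidence_vector S"
proof -
  have k: "1 \<le> k" "k < CARD('n)" using assms(3) by auto
  obtain S where S: "x = incidence_vector S"
    using assms(6) by (auto simp: lagrangian_optimal_def is_arg_min_def binary_vectors_eq)
  obtain T where T: "sparsest_subgraph E k T"
    using sparsest_subgraph_exists[OF assms(1)] k(2) less_imp_le by metis
  have "lagrangian E \<mu> x \<le> lagrangian E \<mu> (incidence_vector T)"
    using assms(6) by (auto simp: lagrangian_optimal_def is_arg_min_def binary_vectors_eq not_less)
  then have opt: "real (card (induced_edges E S)) - \<mu> * real (card S) \<le> min_edges E k - \<mu> * real k"
    using T by (simp add: S lagrangian_incidence[OF assms(1)] sparsest_subgraph_def)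
  have le: "min_edges E (card S) \<le> real (card (induced_edges E S))"
    by (rule min_edges_le[OF assms(1)])
  have "card S = k"
  \<comment> \<open>With any other cardinality, \<open>le\<close> and the strict minimality of
    \<open>k\<close> would make the value of \<open>S\<close> exceed that of \<open>T\<close>,
    against \<open>opt\<close>.\<close>
  proof (rule ccontr)
    assume "card S \<noteq> k"
    then have "min_edges E k - \<mu> * real k < min_edges E (card S) - \<mu> * real (card S)"
      using relaxed_min_edges_less[OF assms(1,2) k(1) _ _ _ _ k(2), of \<mu> "card S"] assms(5)
      by (simp add: card_mono)
    with opt le show False by simp
  qed
  \<comment> \<open>Once \<open>card S = k\<close>, the \<open>\<mu>\<close> terms in
    \<open>opt\<close> cancel, and \<open>le\<close> supplies the reverse inequality.\<close>
  with opt le S show ?thesis by (auto simp: sparsest_subgraph_def)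
qed

end
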